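(* Let $\sigma$ be an even cycle structure (the cycle type of an even permutation of finite support) with $|\mathrm{supp}(\sigma)|=q$. Then $\sigma$ represents a single conjugacy class in the alternating group $\mathrm{Alt}(n)$ for all $n\ge q+2$. Let $n_1<n_2<\cdots$ be a strictly increasing sequence of integers with $n_1\ge q+2$, and for each $i$ let $\varphi_i$ be an arbitrary irreducible normalized character of $\mathrm{Alt}(n_i)$. Then the limit $\lim_{n\to\infty}\prod_{i=1}^n\varphi_i(\sigma)$ exists, where $\varphi_i(\sigma)$ denotes the value of $\varphi_i$ on the conjugacy class of $\mathrm{Alt}(n_i)$ represented by $\sigma$.
   Context: $\mathrm{Alt}(n)$ is the alternating group on $\{1,\dots,n\}$. The support of a permutation is the set of points it moves. A normalized irreducible character of a finite group $H$ is a function $\varphi(h)=\frac{1}{\dim\pi}\mathrm{tr}(\pi(h))$ for an irreducible complex representation $\pi$ of $H$, so $\varphi(e)=1$. *)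

theory Defs
  imports
    "HOL-Algebra.Sym_Groups"
    "HOL-Combinatorics.Orbits"
    "HOL-Library.Multiset"
    "Jordan_Normal_Form.VS_Connect"
begin

definition perm_support :: "('a \<Rightarrow> 'a) \<Rightarrow> 'a set"
  where "perm_support p = {x. p x \<noteq> x}"

text \<open>
  Fixed points are not recorded in a cycle type, so the same cycle type can be realised
  by permutations of sets of different sizes. The orbits are collected as a set first, so every
  nontrivial cycle contributes its length exactly once.
\<close>

definition cycle_type :: "('a \<Rightarrow> 'a) \<Rightarrow> nat multiset"
  where "cycle_type p = image_mset card (mset_set (Orbits.orbit p ` perm_support p))"

text \<open>The predicate \<open>permutation\<close> characterises the bijections of finite support.\<close>

definition even_cycle_structure :: "nat multiset \<Rightarrow> nat \<Rightarrow> bool"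
  where "even_cycle_structure \<sigma> q \<longleftrightarrow>
    (\<exists>s :: nat \<Rightarrow> nat. permutation s \<and> evenperm s \<and> cycle_type s = \<sigma> \<and> card (perm_support s) = q)"

definition alt_cycle_class :: "nat \<Rightarrow> nat multiset \<Rightarrow> (nat \<Rightarrow> nat) set"
  where "alt_cycle_class n \<sigma> = {g \<in> carrier (alt_group n). cycle_type g = \<sigma>}"

definition conjugacy_class :: "('a, 'b) monoid_scheme \<Rightarrow> 'a \<Rightarrow> 'a set"
  where "conjugacy_class G g = {h \<otimes>\<^bsub>G\<^esub> g \<otimes>\<^bsub>G\<^esub> inv\<^bsub>G\<^esub> h | h. h \<in> carrier G}"

definition is_conjugacy_class :: "('a, 'b) monoid_scheme \<Rightarrow> 'a set \<Rightarrow> bool"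
  where "is_conjugacy_class G C \<longleftrightarrow> (\<exists>g \<in> carrier G. C = conjugacy_class G g)"

text \<open>
  Finite-dimensional complex representations are taken in coordinates, as homomorphisms into
  $GL_d(\mathbb{C})$, the unit group of the ring of complex $d \times d$ matrices. This lets
  the dimension vary without a dependent type.
\<close>

definition complex_representation ::
    "('a, 'b) monoid_scheme \<Rightarrow> nat \<Rightarrow> ('a \<Rightarrow> complex mat) \<Rightarrow> bool"
  where "complex_representation G d \<rho> \<longleftrightarrow>
    \<rho> \<in> hom G (units_of (ring_mat TYPE(complex) d ()))"

definition irreducible_representation ::
    "('a, 'b) monoid_scheme \<Rightarrow> nat \<Rightarrow> ('a \<Rightarrow> complex mat) \<Rightarrow> bool"
  where "irreducible_representation G d \<rho> \<longleftrightarrow>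
    complex_representation G d \<rho> \<and> d > 0 \<and>
    (\<forall>W. VectorSpace.subspace class_ring W (module_vec TYPE(complex) d) \<and>
         (\<forall>g \<in> carrier G. \<forall>w \<in> W. \<rho> g *\<^sub>v w \<in> W)
         \<longrightarrow> W = {0\<^sub>v d} \<or> W = carrier_vec d)"

definition mat_trace :: "complex mat \<Rightarrow> complex"
  where "mat_trace A = (\<Sum>i<dim_row A. A $$ (i, i))"

text \<open>A character is only constrained on the carrier; its values elsewhere are irrelevant.\<close>

definition normalized_irreducible_character ::
    "('a, 'b) monoid_scheme \<Rightarrow> ('a \<Rightarrow> complex) \<Rightarrow> bool"
  where "normalized_irreducible_character G \<phi> \<longleftrightarrow>
    (\<exists>d \<rho>. irreducible_representation G d \<rho> \<and>
           (\<forall>g \<in> carrier G. \<phi> g = mat_trace (\<rho> g) / of_nat d))"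

end

theory Submission
  imports Defs "Jordan_Normal_Form.Schur_Decomposition"
begin

text \<open>
  Only the values of the characters near \<open>-1\<close> matter: if the product of the absolute values
  does not tend to \<open>0\<close>, the factors have absolute value tending to \<open>1\<close>, and since they are
  real and lie in \<open>[-1, 1]\<close>, it suffices to bound them away from \<open>-1\<close> uniformly in \<open>n\<close>.

  A normalized character is positive definite, so \<open>2 + 2 * \<phi> s\<close> is the squared
  Hilbert--Schmidt distance from a unitary \<open>\<rho> s\<close> to \<open>-1\<close>. If it is small, a product of an
  even number of conjugates of \<open>s\<close> is mapped close to \<open>+1\<close>. But \<open>s\<close> itself is such a
  product: it is a product of 3-cycles, and each 3-cycle is the commutator of a conjugate of
  \<open>s\<close> with a transposition, hence a product of two elements of the class of \<open>s\<close>. The number of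
  factors is independent of \<open>n\<close>, so \<open>\<phi> s\<close> cannot approach \<open>-1\<close>.
\<close>

subsection \<open>Cycle types and conjugacy\<close>

text \<open>Orbits of the conjugate are the images under \<open>h\<close> of the orbits of
  \<open>p\<close>. Taking images under a bijection is injective on sets, so the set of orbits is
  reindexed without merging any two.\<close>

lemma cycle_type_conj:
  assumes h: "bij h"
  shows "cycle_type (h \<circ> p \<circ> inv' h) = cycle_type p"
proof -
  let ?p' = "h \<circ> p \<circ> inv' h"
  have inv_h: "inv' h (h x) = x" "h (inv' h y) = y" for x y
    using h by (simp_all add: bij_is_inj bij_is_surj surj_f_inv_f)
  have "?p' x \<noteq> x \<longleftrightarrow> p (inv' h x) \<noteq> inv' h x" for x
    using inv_h by (metis comp_apply)
  then have supp: "perm_support ?p' = h ` perm_support p"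
    unfolding perm_support_def bij_image_Collect_eq[OF h] by blast
  have funpow: "(?p' ^^ n) (h x) = h ((p ^^ n) x)" for n x
    by (induction n) (simp_all add: inv_h)
  have orbit: "Orbits.orbit ?p' (h x) = h ` Orbits.orbit p x" for x
    unfolding Orbits.orbit_altdef by (auto simp: funpow simp del: comp_apply)
  let ?O = "Orbits.orbit p ` perm_support p"
  have "Orbits.orbit ?p' ` perm_support ?p' = (`) h ` ?O"
    unfolding supp by (simp add: image_image orbit)
  moreover have "inj_on ((`) h) ?O"
    using h by (meson bij_is_inj inj_image_eq_iff inj_onI)
  ultimately have "cycle_type ?p' = image_mset (card \<circ> (`) h) (mset_set ?O)"
    unfolding cycle_type_def by (simp add: multiset.map_comp flip: image_mset_mset_set)
  also have "card \<circ> (`) h = card"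
    using h by (auto simp: card_image bij_is_inj[THEN inj_on_subset])
  finally show ?thesis by (simp only: cycle_type_def)
qed

lemma cycle_type_inv:
  assumes "permutation p"
  shows "cycle_type (inv' p) = cycle_type p"
proof -
  have "bij p" by (rule permutation_bijective[OF assms])
  then have "perm_support (inv' p) = perm_support p"
    unfolding perm_support_def by (metis bij_inv_eq_iff)
  then show ?thesis
    by (simp add: cycle_type_def orbit_inv_eq[OF assms])
qed

text \<open>The first return time \<open>funpow_dist1 p x x\<close> is the length of the cycle: the
  powers below it run through the orbit exactly once, starting at \<open>x\<close> itself.\<close>

lemma permutation_orbit_enum:
  assumes "permutation p"
  shows "bij_betw (\<lambda>n. (p ^^ n) x) {0..<card (Orbits.orbit p x)} (Orbits.orbit p x)"
    and "(p ^^ card (Orbits.orbit p x)) x = x"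
proof -
  have x: "x \<in> Orbits.orbit p x"
    by (rule permutation_self_in_orbit[OF assms])
  have bij: "bij_betw (\<lambda>n. (p ^^ n) x) {0..<funpow_dist1 p x x} (Orbits.orbit p x)"
    using inj_on_funpow_dist1[OF x] orbit_conv_funpow_dist1[OF x] by (simp add: bij_betw_def)
  then have card: "card (Orbits.orbit p x) = funpow_dist1 p x x"
    using bij_betw_same_card by fastforce
  show "bij_betw (\<lambda>n. (p ^^ n) x) {0..<card (Orbits.orbit p x)} (Orbits.orbit p x)"
    using bij by (simp add: card)
  show "(p ^^ card (Orbits.orbit p x)) x = x"
    unfolding card by (rule funpow_dist1_prop[OF x])
qed

text \<open>The n-th iterate of \<open>x\<close> is sent to the n-th iterate of \<open>y\<close>;
  equality of the cycle lengths makes this consistent.\<close>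

lemma orbits_intertwined:
  assumes p: "permutation p" and p': "permutation p'"
    and card: "card (Orbits.orbit p x) = card (Orbits.orbit p' y)"
  shows "\<exists>b. bij_betw b (Orbits.orbit p x) (Orbits.orbit p' y)
    \<and> (\<forall>z \<in> Orbits.orbit p x. b (p z) = p' (b z))"
proof -
  let ?N = "card (Orbits.orbit p x)"
  define b where "b = (\<lambda>z. (p' ^^ inv_into {0..<?N} (\<lambda>n. (p ^^ n) x) z) y)"
  note enum = permutation_orbit_enum[OF p, of x]
  note enum' = permutation_orbit_enum[OF p', of y, folded card]
  have "bij_betw b (Orbits.orbit p x) (Orbits.orbit p' y)"
    using bij_betw_trans[OF bij_betw_inv_into[OF enum(1)] enum'(1)]
    by (simp add: b_def comp_def)
  moreover have N: "?N > 0"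
    using bij_betw_imp_surj_on[OF enum(1)] orbit_nonempty[of p x] by (cases ?N) auto
  \<comment> \<open>\<open>b\<close> is defined through the exponent below \<open>?N\<close>. Both
    sequences of iterates have period \<open>?N\<close>, so the formula extends to every exponent,
    including the wrap-around at the end of the cycle.\<close>
  have b_funpow: "b ((p ^^ n) x) = (p' ^^ n) y" for n
  proof -
    have "b ((p ^^ n) x) = b ((p ^^ (n mod ?N)) x)"
      by (simp add: funpow_mod_eq[OF enum(2)])
    also have "\<dots> = (p' ^^ (n mod ?N)) y"
      using inv_into_f_f[OF bij_betw_imp_inj_on[OF enum(1)], of "n mod ?N"] N
      by (simp add: b_def)
    also have "\<dots> = (p' ^^ n) y"
      by (simp add: funpow_mod_eq[OF enum'(2)])
    finally show ?thesis .
  qed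
  have "b (p z) = p' (b z)" if "z \<in> Orbits.orbit p x" for z
  proof -
    from that obtain n where "z = (p ^^ n) x"
      unfolding Orbits.orbit_altdef by blast
    then show ?thesis
      using b_funpow[of n] b_funpow[of "Suc n"] by simp
  qed
  ultimately show ?thesis by blast
qed

text \<open>An arbitrary bijection between the equally large sets may mismatch the labels; a
  permutation of \<open>A\<close>, supplied by the equality of the multisets, repairs this.\<close>

lemma image_mset_eq_imp_bij_betw:
  assumes fin: "finite A" "finite B"
    and eq: "image_mset f (mset_set A) = image_mset g (mset_set B)"
  obtains h where "bij_betw h A B" "\<And>a. a \<in> A \<Longrightarrow> g (h a) = f a"
proof -
  have "card A = card B"
    using arg_cong[OF eq, of size] by simp
  then obtain k where k: "bij_betw k A B"
    using finite_same_card_bij[OF fin] by blast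
  have "image_mset (g \<circ> k) (mset_set A) = image_mset g (mset_set B)"
    using k by (simp add: bij_betw_def image_mset_mset_set flip: multiset.map_comp)
  then obtain p where p: "p permutes A" "\<forall>a\<in>A. f a = (g \<circ> k) (p a)"
    using image_mset_eq_implies_permutes[OF fin(1), of f "g \<circ> k"] eq by metis
  show thesis
  proof
    show "bij_betw (k \<circ> p) A B"
      by (rule bij_betw_trans[OF permutes_imp_bij[OF p(1)] k])
    show "g ((k \<circ> p) a) = f a" if "a \<in> A" for a
      using p(2) that by simp
  qed
qed

lemma orbit_disjoint:
  assumes "permutation p" "Orbits.orbit p x \<noteq> Orbits.orbit p y"
  shows "Orbits.orbit p x \<inter> Orbits.orbit p y = {}"
  using assms(2) orbit_cyclic_eq3[OF cyclic_on_orbit'[OF assms(1)]] by blast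

lemma orbit_subset_perm_support:
  assumes "permutation p" "x \<in> perm_support p"
  shows "Orbits.orbit p x \<subseteq> perm_support p"
proof
  fix y assume y: "y \<in> Orbits.orbit p x"
  have "Orbits.orbit p y = Orbits.orbit p x"
    by (rule orbit_cyclic_eq3[OF cyclic_on_orbit'[OF assms(1)] y])
  moreover have "x \<in> Orbits.orbit p x"
    by (rule permutation_self_in_orbit[OF assms(1)])
  moreover have "Orbits.orbit p x \<noteq> {x}"
    using assms(2) by (simp add: perm_support_def orbit_eq_singleton_iff)
  ultimately have "Orbits.orbit p y \<noteq> {y}" by auto
  then show "y \<in> perm_support p"
    by (simp add: perm_support_def orbit_eq_singleton_iff)
qed

lemma Union_orbits_perm_support:
  assumes "permutation p"
  shows "\<Union> (Orbits.orbit p ` perm_support p) = perm_support p"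
  using orbit_subset_perm_support[OF assms] permutation_self_in_orbit[OF assms] by blast

lemma finite_perm_support: "permutation p \<Longrightarrow> finite (perm_support p)"
  by (simp add: perm_support_def permutation)

text \<open>The nontrivial orbits are matched by a length-preserving bijection \<open>F\<close>, an
  intertwiner is chosen on each orbit, and the pieces are glued, the supports being disjoint unions
  of these orbits.\<close>

lemma supports_intertwined:
  assumes p: "permutation p" and p': "permutation p'"
    and eq: "cycle_type p = cycle_type p'"
  obtains b where "bij_betw b (perm_support p) (perm_support p')"
    "\<And>z. z \<in> perm_support p \<Longrightarrow> b (p z) = p' (b z)"
proof -
  let ?O = "Orbits.orbit p ` perm_support p" and ?O' = "Orbits.orbit p' ` perm_support p'"
  have "finite ?O" "finite ?O'"
    using p p' by (simp_all add: finite_perm_support)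
  then obtain F where F: "bij_betw F ?O ?O'" "\<And>c. c \<in> ?O \<Longrightarrow> card (F c) = card c"
    using image_mset_eq_imp_bij_betw[of ?O ?O' card card] eq unfolding cycle_type_def by blast
  have "\<forall>c\<in>?O. \<exists>b. bij_betw b c (F c) \<and> (\<forall>z\<in>c. b (p z) = p' (b z))"
  proof
    fix c assume c: "c \<in> ?O"
    obtain x where x: "c = Orbits.orbit p x" using c by blast
    have "F c \<in> ?O'" using F(1) c by (rule bij_betw_apply)
    then obtain y where y: "F c = Orbits.orbit p' y" by blast
    show "\<exists>b. bij_betw b c (F c) \<and> (\<forall>z\<in>c. b (p z) = p' (b z))"
      using orbits_intertwined[OF p p', of x y] F(2)[OF c] x y by simp
  qed
  then obtain B where B: "\<forall>c\<in>?O. bij_betw (B c) c (F c) \<and> (\<forall>z\<in>c. B c (p z) = p' (B c z))"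
    by (rule bchoice[THEN exE])
  define b where "b z = B (Orbits.orbit p z) z" for z
  have orbit_eq: "Orbits.orbit p z = c" if "c \<in> ?O" "z \<in> c" for c z
    using that orbit_cyclic_eq3[OF cyclic_on_orbit'[OF p]] by blast
  have "bij_betw b (\<Union>c\<in>?O. c) (\<Union>c\<in>?O. F c)"
  proof (rule bij_betw_UNION_disjoint)
    show "disjoint_family_on F ?O"
    proof (unfold disjoint_family_on_def, intro ballI impI)
      fix c c' assume cc': "c \<in> ?O" "c' \<in> ?O" "c \<noteq> c'"
      then have "F c \<noteq> F c'" "F c \<in> ?O'" "F c' \<in> ?O'"
        using bij_betw_imp_inj_on[OF F(1)] bij_betw_apply[OF F(1)] by (blast dest: inj_onD)+
      then show "F c \<inter> F c' = {}"
        using orbit_disjoint[OF p'] by blast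
    qed
    show "bij_betw b c (F c)" if c: "c \<in> ?O" for c
    proof -
      have "b z = B c z" if "z \<in> c" for z
        using orbit_eq[OF c that] by (simp only: b_def)
      then have "bij_betw b c (F c) = bij_betw (B c) c (F c)"
        by (rule bij_betw_cong)
      with B c show ?thesis by blast
    qed
  qed
  then have "bij_betw b (perm_support p) (perm_support p')"
    using Union_orbits_perm_support[OF p] Union_orbits_perm_support[OF p']
      bij_betw_imp_surj_on[OF F(1)] by simp
  moreover have "b (p z) = p' (b z)" if "z \<in> perm_support p" for z
    using B that permutation_self_in_orbit[OF p, of z]
    by (simp add: b_def permutation_orbit_step[OF p])
  ultimately show thesis using that by blast
qed

section \<open>Conjugating permutations of a finite set\<close>

lemma permutes_extending_bij_betw:
  assumes S: "finite S" "A \<subseteq> S" "B \<subseteq> S" and b: "bij_betw b A B"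
  obtains h where "h permutes S" "\<And>x. x \<in> A \<Longrightarrow> h x = b x"
proof -
  \<comment> \<open>Removing equally large sets from the finite set \<open>S\<close> leaves equally
    large remainders, so \<open>b\<close> can be completed by a bijection \<open>c\<close> between
    them.\<close>
  have "card (S - A) = card (S - B)"
    using S bij_betw_same_card[OF b] by (simp add: card_Diff_subset finite_subset)
  then obtain c where c: "bij_betw c (S - A) (S - B)"
    using finite_same_card_bij[of "S - A" "S - B"] S(1) by auto
  define h where "h x = (if x \<in> A then b x else if x \<in> S then c x else x)" for x
  have "bij_betw h (A \<union> (S - A)) (B \<union> (S - B))"
  proof (rule bij_betw_combine)
    show "bij_betw h A B"
      using b by (subst bij_betw_cong[of A h b]) (auto simp: h_def)
    show "bij_betw h (S - A) (S - B)"
      using c by (subst bij_betw_cong[of "S - A" h c]) (auto simp: h_def)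
  qed auto
  then have "bij_betw h S S" using S by (simp add: Un_absorb1)
  then have "h permutes S"
    using S(2) by (intro bij_imp_permutes) (auto simp: h_def)
  then show thesis using that by (simp add: h_def)
qed

text \<open>The intertwiner of the supports extends to a permutation of \<open>S\<close>. Off the
  supports any extension will do, because \<open>p\<close> and \<open>p'\<close> are the identity
  there.\<close>

lemma cycle_type_eq_imp_conj:
  assumes S: "finite S" and p: "p permutes S" and p': "p' permutes S"
    and eq: "cycle_type p = cycle_type p'"
  obtains h where "h permutes S" "h \<circ> p = p' \<circ> h"
proof -
  have perm: "permutation p" "permutation p'"
    using S p p' permutation_permutes by blast+
  have supp: "perm_support p \<subseteq> S" "perm_support p' \<subseteq> S"
    using p p' by (auto simp: perm_support_def permutes_def)
  obtain b where b: "bij_betw b (perm_support p) (perm_support p')"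
    "\<And>z. z \<in> perm_support p \<Longrightarrow> b (p z) = p' (b z)"
    using supports_intertwined[OF perm eq] by blast
  obtain h where h: "h permutes S" "\<And>x. x \<in> perm_support p \<Longrightarrow> h x = b x"
    using permutes_extending_bij_betw[OF S supp b(1)] by blast
  have "h (p z) = p' (h z)" for z
  proof (cases "z \<in> perm_support p")
    case True
    then have "p z \<in> perm_support p"
      using orbit_subset_perm_support[OF perm(1)] orbit.base by fastforce
    with True show ?thesis by (simp add: h(2) b(2))
  next
    case False
    have "h ` perm_support p = perm_support p'"
      using bij_betw_imp_surj_on[OF b(1)] h(2) by (simp cong: image_cong)
    then have "h z \<notin> perm_support p'"
      using False inj_image_mem_iff[OF permutes_inj[OF h(1)]] by metis
    with False show ?thesis by (simp add: perm_support_def)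
  qed
  then show thesis using that h(1) by (simp add: fun_eq_iff)
qed

lemma card_perm_support_cong:
  assumes "permutation p" "permutation p'" "cycle_type p = cycle_type p'"
  shows "card (perm_support p) = card (perm_support p')"
  using supports_intertwined[OF assms] bij_betw_same_card by metis

lemma evenperm_conj:
  assumes "permutation h" "permutation p"
  shows "evenperm (h \<circ> p \<circ> inv' h) \<longleftrightarrow> evenperm p"
  using assms
  by (auto simp: evenperm_comp permutation_compose permutation_inverse evenperm_inv)

text \<open>Two common fixed points allow the parity of the conjugating permutation to be corrected.\<close>

lemma cycle_type_eq_imp_conj_evenperm:
  assumes S: "finite S" and p: "p permutes S" and p': "p' permutes S"
    and eq: "cycle_type p = cycle_type p'" and card: "card (perm_support p) + 2 \<le> card S"
  obtains h where "h permutes S" "evenperm h" "h \<circ> p = p' \<circ> h"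
proof -
  obtain h where h: "h permutes S" "h \<circ> p = p' \<circ> h"
    by (rule cycle_type_eq_imp_conj[OF S p p' eq])
  have "permutation h" using S h(1) permutation_permutes by blast
  have "perm_support p \<subseteq> S"
    using p by (auto simp: perm_support_def permutes_def)
  then have "2 \<le> card (S - perm_support p)"
    using card S by (simp add: card_Diff_subset finite_subset)
  then obtain T where "T \<subseteq> S - perm_support p" "card T = 2"
    by (rule obtain_subset_with_card_n)
  then obtain x y where xy: "x \<in> S - perm_support p" "y \<in> S - perm_support p" "x \<noteq> y"
    unfolding card_2_iff by blast
  define t where "t = Transposition.transpose x y"
  have fixed: "p x = x" "p y = y" using xy by (auto simp: perm_support_def)
  then have "p z = x \<longleftrightarrow> z = x" "p z = y \<longleftrightarrow> z = y" for z
    using inj_eq[OF permutes_inj[OF p]] by metis+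
  \<comment> \<open>Swapping two fixed points commutes with \<open>p\<close>, so \<open>h\<close>
    and \<open>h \<circ> t\<close> conjugate \<open>p\<close> alike, and exactly one of them is
    even.\<close>
  then have "t \<circ> p = p \<circ> t"
    by (auto simp: fixed fun_eq_iff t_def Transposition.transpose_def)
  then have "(h \<circ> t) \<circ> p = p' \<circ> (h \<circ> t)"
    by (metis comp_assoc h(2))
  moreover have "(h \<circ> t) permutes S"
    using xy h(1) by (auto simp: t_def intro!: permutes_compose permutes_swap_id)
  moreover have "evenperm (h \<circ> t) \<longleftrightarrow> \<not> evenperm h"
    using \<open>permutation h\<close> xy(3)
    by (simp add: t_def evenperm_comp permutation_swap_id evenperm_swap)
  ultimately show thesis using that h by blast
qed

section \<open>Cycle types in alternating groups\<close>

lemma alt_cycle_class_conj: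
  assumes h: "h permutes {1..n}" and g: "g \<in> alt_cycle_class n \<sigma>"
  shows "h \<circ> g \<circ> inv' h \<in> alt_cycle_class n \<sigma>"
proof -
  have "permutation h" "permutation g"
    using h g by (auto simp: alt_cycle_class_def alt_group_carrier permutation_permutes)
  then show ?thesis
    using g h cycle_type_conj[OF permutes_bij[OF h], of g]
    by (auto simp: alt_cycle_class_def alt_group_carrier evenperm_conj
        intro!: permutes_compose permutes_inv)
qed

lemma alt_cycle_class_inv:
  assumes "g \<in> alt_cycle_class n \<sigma>"
  shows "inv' g \<in> alt_cycle_class n \<sigma>"
  using assms cycle_type_inv[OF alt_group_carrier'] alt_group_inv_closed
  unfolding alt_cycle_class_def by blast

lemma alt_group_carrier_mono: "m \<le> n \<Longrightarrow> carrier (alt_group m) \<subseteq> carrier (alt_group n)"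
  by (auto simp: alt_group_carrier elim!: permutes_subset)

lemma alt_cycle_class_mono: "m \<le> n \<Longrightarrow> alt_cycle_class m \<sigma> \<subseteq> alt_cycle_class n \<sigma>"
  using alt_group_carrier_mono by (auto simp: alt_cycle_class_def)

lemma even_cycle_structure_card:
  assumes "even_cycle_structure \<sigma> q" "g \<in> alt_cycle_class n \<sigma>"
  shows "card (perm_support g) = q"
proof -
  obtain s :: "nat \<Rightarrow> nat" where "permutation s" "cycle_type s = \<sigma>" "card (perm_support s) = q"
    using assms(1) unfolding even_cycle_structure_def by blast
  moreover have "permutation g" "cycle_type g = \<sigma>"
    using assms(2) alt_group_carrier' unfolding alt_cycle_class_def by blast+
  ultimately show ?thesis
    using card_perm_support_cong[of g s] by simp
qed

text \<open>The permutation \<open>s\<close> realising the cycle structure may move arbitrary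
  naturals, 0 included; a conjugation carries its support onto \<open>{1..q}\<close>.\<close>

lemma alt_cycle_class_nonempty:
  assumes "even_cycle_structure \<sigma> q" "q \<le> n"
  shows "alt_cycle_class n \<sigma> \<noteq> {}"
proof -
  obtain s :: "nat \<Rightarrow> nat" where s: "permutation s" "evenperm s" "cycle_type s = \<sigma>"
      "card (perm_support s) = q"
    using assms(1) by (auto simp: even_cycle_structure_def)
  have fin: "finite (perm_support s)" by (rule finite_perm_support[OF s(1)])
  obtain b where b: "bij_betw b (perm_support s) {1..q}"
    using finite_same_card_bij[OF fin, of "{1..q}"] s(4) by auto
  \<comment> \<open>A finite set containing both the old and the new support, on which
    \<open>b\<close> can be completed to a permutation.\<close>
  let ?S = "perm_support s \<union> {1..q}"
  obtain h where h: "h permutes ?S" "\<And>x. x \<in> perm_support s \<Longrightarrow> h x = b x"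
    using permutes_extending_bij_betw[of ?S, OF _ _ _ b] fin by blast
  have "permutation h" using h(1) fin permutation_permutes by blast
  let ?g = "h \<circ> s \<circ> inv' h"
  have "permutation ?g"
    using s(1) \<open>permutation h\<close> by (intro permutation_compose permutation_inverse)
  moreover have "?g x = x" if "x \<notin> {1..q}" for x
  proof -
    have "inv' h x \<notin> perm_support s"
    proof
      assume *: "inv' h x \<in> perm_support s"
      then have "h (inv' h x) \<in> {1..q}"
        using bij_betw_apply[OF b *] by (simp only: h(2)[OF *])
      with that show False by (simp only: permutes_inverses(1)[OF h(1)])
    qed
    then show ?thesis
      by (simp add: perm_support_def permutes_inverses(1)[OF h(1)])
  qed
  ultimately have "?g permutes {1..q}"
    using permutation_bijective[of ?g] unfolding permutes_def bij_iff by blast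
  moreover have "evenperm ?g"
    using evenperm_conj[OF \<open>permutation h\<close> s(1)] s(2) by simp
  moreover have "cycle_type ?g = \<sigma>"
    using cycle_type_conj[OF permutes_bij[OF h(1)]] s(3) by simp
  ultimately have "?g \<in> alt_cycle_class q \<sigma>"
    by (simp add: alt_cycle_class_def alt_group_carrier)
  then show ?thesis using alt_cycle_class_mono[OF assms(2)] by blast
qed

lemma conjugacy_class_alt_group:
  "conjugacy_class (alt_group n) g = {h \<circ> g \<circ> inv' h | h. h \<in> carrier (alt_group n)}"
  unfolding conjugacy_class_def
  by (intro Collect_cong ex_cong1) (auto simp: alt_group_mult alt_group_inv_equality)

text \<open>The two spare points allow an even conjugating permutation, so the class of the
  symmetric group does not split in \<open>alt_group n\<close>.\<close>

lemma alt_cycle_class_eq_conjugacy_class: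
  assumes \<sigma>: "even_cycle_structure \<sigma> q" and n: "q + 2 \<le> n" and g: "g \<in> alt_cycle_class n \<sigma>"
  shows "alt_cycle_class n \<sigma> = conjugacy_class (alt_group n) g"
proof
  show "alt_cycle_class n \<sigma> \<subseteq> conjugacy_class (alt_group n) g"
  proof
    fix g' assume g': "g' \<in> alt_cycle_class n \<sigma>"
    have "card (perm_support g) + 2 \<le> card {1..n}"
      using even_cycle_structure_card[OF \<sigma> g] n by simp
    then obtain h where h: "h permutes {1..n}" "evenperm h" "h \<circ> g = g' \<circ> h"
      using cycle_type_eq_imp_conj_evenperm[of "{1..n}" g g'] g g'
      by (auto simp: alt_cycle_class_def alt_group_carrier)
    have "h \<circ> g \<circ> inv' h = g'"
      unfolding h(3) comp_assoc permutes_inv_o(1)[OF h(1)] by simp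
    then show "g' \<in> conjugacy_class (alt_group n) g"
      using h unfolding conjugacy_class_alt_group alt_group_carrier by blast
  qed
  show "conjugacy_class (alt_group n) g \<subseteq> alt_cycle_class n \<sigma>"
    using alt_cycle_class_conj[OF _ g]
    by (auto simp: conjugacy_class_alt_group alt_group_carrier)
qed

text \<open>
  For \<open>s\<close> moving \<open>x\<close> and fixing \<open>y\<close>, the commutator of
  \<open>s\<close> and the transposition of \<open>x\<close> and \<open>y\<close> is the
  3-cycle \<open>[s x, y, x]\<close>.
\<close>

lemma three_cycle_eq_class_mult:
  assumes s: "s \<in> alt_cycle_class n \<sigma>" "s \<noteq> id" "card (perm_support s) < n"
    and t: "t \<in> three_cycles n"
  obtains s1 s2 where "s1 \<in> alt_cycle_class n \<sigma>" "s2 \<in> alt_cycle_class n \<sigma>" "t = s1 \<circ> s2"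
proof -
  have s_permutes: "s permutes {1..n}"
    using s(1) by (simp add: alt_cycle_class_def alt_group_carrier)
  obtain x where x: "s x \<noteq> x" using s(2) by (auto simp: fun_eq_iff)
  have x_in: "x \<in> {1..n}" using x s_permutes by (metis permutes_not_in)
  have "perm_support s \<subseteq> {1..n}"
    using s_permutes by (auto simp: perm_support_def permutes_def)
  then have "perm_support s \<noteq> {1..n}" using s(3) by force
  then obtain y where "y \<in> {1..n}" "y \<notin> perm_support s"
    using \<open>perm_support s \<subseteq> {1..n}\<close> by blast
  then have y: "y \<in> {1..n}" "s y = y" by (simp_all add: perm_support_def)
  obtain cs where cs: "t = cycle_of_list cs" "distinct cs" "length cs = 3" "set cs \<subseteq> {1..n}"
    using t by blast
  then obtain a b c where abc: "cs = [a, b, c]"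
    by (auto simp: numeral_3_eq_3 length_Suc_conv)
  \<comment> \<open>The conjugator \<open>h\<close> is to carry the cycle \<open>[s x, y, x]\<close>
    to \<open>[a, b, c]\<close>; the conjugate \<open>s1\<close> of \<open>s\<close> then maps
    \<open>c\<close> to \<open>a\<close> and fixes \<open>b\<close>.\<close>
  define f where "f z = (if z = s x then a else if z = y then b else c)" for z
  have "y \<noteq> x" "y \<noteq> s x" using x y(2) permutes_inj[OF s_permutes] by (auto dest: injD)
  then have "bij_betw f {s x, y, x} {a, b, c}"
    using x cs(2) abc by (auto simp: f_def bij_betw_def inj_on_def)
  moreover have "s x \<in> {1..n}" using permutes_in_image[OF s_permutes] x_in by blast
  ultimately obtain h where h: "h permutes {1..n}" "\<And>z. z \<in> {s x, y, x} \<Longrightarrow> h z = f z"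
    using permutes_extending_bij_betw[of "{1..n}" "{s x, y, x}" "{a, b, c}" f]
      x_in y(1) cs(4) abc by auto
  have hv: "h (s x) = a" "h y = b" "h x = c"
    using x \<open>y \<noteq> x\<close> \<open>y \<noteq> s x\<close> by (auto simp: h(2) f_def)
  define s1 where "s1 = h \<circ> s \<circ> inv' h"
  have s1: "s1 \<in> alt_cycle_class n \<sigma>"
    unfolding s1_def by (rule alt_cycle_class_conj[OF h(1) s(1)])
  have s1_bij: "bij s1"
    using s1 by (auto simp: alt_cycle_class_def alt_group_carrier permutes_bij)
  have s1_ab: "s1 c = a" "s1 b = b"
    using hv y(2) by (simp_all add: s1_def permutes_inverses(2)[OF h(1)] flip: hv)
  define \<tau> where "\<tau> = Transposition.transpose c b"
  \<comment> \<open>Conjugating by the odd permutation \<tau> is harmless: membership in the class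
    is a condition on the cycle type, which inversion and any conjugation preserve.\<close>
  define s2 where "s2 = \<tau> \<circ> inv' s1 \<circ> \<tau>"
  have \<tau>: "\<tau> permutes {1..n}"
    using cs(4) abc by (auto simp: \<tau>_def intro: permutes_swap_id)
  have "inv' \<tau> = \<tau>" by (simp add: \<tau>_def)
  then have s2: "s2 \<in> alt_cycle_class n \<sigma>"
    unfolding s2_def using alt_cycle_class_conj[OF \<tau> alt_cycle_class_inv[OF s1]] by simp
  \<comment> \<open>Conjugating the transposition of \<open>c\<close> and \<open>b\<close> by
    \<open>s1\<close> gives that of \<open>a\<close> and \<open>b\<close>. Followed on the right by
    \<tau>, this is the 3-cycle \<open>[a, b, c]\<close>.\<close>
  have "s1 (\<tau> w) = Transposition.transpose a b (s1 w)" for w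
    using inj_eq[OF bij_is_inj[OF s1_bij], of w c] inj_eq[OF bij_is_inj[OF s1_bij], of w b]
    by (simp add: \<tau>_def Transposition.transpose_def s1_ab)
  then have "s1 (\<tau> (inv' s1 z)) = Transposition.transpose a b z" for z
    using surj_f_inv_f[OF bij_is_surj[OF s1_bij]] by simp
  then have "t = s1 \<circ> s2"
    by (simp add: cs(1) abc fun_eq_iff s2_def \<tau>_def transpose_commute[of b c])
  then show thesis using that s1 s2 by blast
qed

subsection \<open>Positive definiteness of characters\<close>

lemma mat_adjoint_carrier [simp]:
  fixes A :: "complex mat"
  assumes "A \<in> carrier_mat m n"
  shows "mat_adjoint A \<in> carrier_mat n m"
  using assms by (auto simp: mat_adjoint_def)

lemma dim_mat_adjoint [simp]:
  fixes A :: "complex mat"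
  shows "dim_row (mat_adjoint A) = dim_col A" "dim_col (mat_adjoint A) = dim_row A"
  by (simp_all add: mat_adjoint_def)

lemma index_mat_adjoint:
  fixes A :: "complex mat"
  assumes "A \<in> carrier_mat m n" "i < n" "j < m"
  shows "mat_adjoint A $$ (i, j) = cnj (A $$ (j, i))"
  using assms by (auto simp: mat_adjoint_def mat_of_rows_def conjugate_complex_def)

lemma mat_adjoint_mult:
  fixes A :: "complex mat"
  assumes A: "A \<in> carrier_mat m n" and B: "B \<in> carrier_mat n k"
  shows "mat_adjoint (A * B) = mat_adjoint B * mat_adjoint A"
proof -
  have AB: "A * B \<in> carrier_mat m k" using A B by simp
  show ?thesis
  proof (rule eq_matI)
    fix i j assume "i < dim_row (mat_adjoint B * mat_adjoint A)"
      and "j < dim_col (mat_adjoint B * mat_adjoint A)"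
    then have ij: "i < k" "j < m"
      using mat_adjoint_carrier[OF A] mat_adjoint_carrier[OF B] by auto
    have "(mat_adjoint B * mat_adjoint A) $$ (i, j)
        = (\<Sum>l = 0..<n. mat_adjoint B $$ (i, l) * mat_adjoint A $$ (l, j))"
      using ij A B by (auto simp: scalar_prod_def intro!: sum.cong)
    also have "\<dots> = (\<Sum>l = 0..<n. cnj (A $$ (j, l) * B $$ (l, i)))"
      using ij A B by (intro sum.cong) (auto simp: index_mat_adjoint)
    also have "\<dots> = mat_adjoint (A * B) $$ (i, j)"
      using ij A B by (auto simp: index_mat_adjoint[OF AB] scalar_prod_def)
    finally show "mat_adjoint (A * B) $$ (i, j) = (mat_adjoint B * mat_adjoint A) $$ (i, j)" ..
  qed (use mat_adjoint_carrier[OF A] mat_adjoint_carrier[OF B] mat_adjoint_carrier[OF AB] in auto)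
qed

lemma mat_adjoint_adjoint:
  fixes A :: "complex mat"
  assumes A: "A \<in> carrier_mat m n"
  shows "mat_adjoint (mat_adjoint A) = A"
  using A mat_adjoint_carrier[OF A] mat_adjoint_carrier[OF mat_adjoint_carrier[OF A]]
  by (intro eq_matI) (auto simp: index_mat_adjoint[OF A] index_mat_adjoint[OF mat_adjoint_carrier[OF A]])

lemma mat_adjoint_smult:
  fixes A :: "complex mat"
  assumes A: "A \<in> carrier_mat m n"
  shows "mat_adjoint (c \<cdot>\<^sub>m A) = cnj c \<cdot>\<^sub>m mat_adjoint A"
proof -
  have cA: "c \<cdot>\<^sub>m A \<in> carrier_mat m n" using A by simp
  show ?thesis
    using A mat_adjoint_carrier[OF A] mat_adjoint_carrier[OF cA]
    by (intro eq_matI) (auto simp: index_mat_adjoint[OF A] index_mat_adjoint[OF cA])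
qed

lemma mat_adjoint_one: "mat_adjoint (1\<^sub>m n :: complex mat) = 1\<^sub>m n"
proof -
  have c: "(1\<^sub>m n :: complex mat) \<in> carrier_mat n n" by simp
  show ?thesis
    using mat_adjoint_carrier[OF c]
    by (intro eq_matI) (auto simp: index_mat_adjoint[OF c])
qed

lemma mat_trace_adjoint:
  assumes A: "A \<in> carrier_mat n n"
  shows "mat_trace (mat_adjoint A) = cnj (mat_trace A)"
  using A mat_adjoint_carrier[OF A] by (auto simp: mat_trace_def index_mat_adjoint[OF A])

lemma mat_trace_smult:
  assumes "A \<in> carrier_mat n n"
  shows "mat_trace (c \<cdot>\<^sub>m A) = c * mat_trace A"
  using assms by (auto simp: mat_trace_def sum_distrib_left)

lemma mat_trace_mult_comm:
  assumes A: "A \<in> carrier_mat m n" and B: "B \<in> carrier_mat n m"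
  shows "mat_trace (A * B) = mat_trace (B * A)"
proof -
  have "mat_trace (A * B) = (\<Sum>i<m. \<Sum>j<n. A $$ (i, j) * B $$ (j, i))"
    using A B by (auto simp: mat_trace_def scalar_prod_def atLeast0LessThan intro!: sum.cong)
  also have "\<dots> = (\<Sum>j<n. \<Sum>i<m. B $$ (j, i) * A $$ (i, j))"
    by (subst sum.swap) (simp add: mult.commute)
  also have "\<dots> = mat_trace (B * A)"
    using A B by (auto simp: mat_trace_def scalar_prod_def atLeast0LessThan intro!: sum.cong)
  finally show ?thesis .
qed

text \<open>This is the squared Frobenius norm; every positivity statement about representations
  below reduces to it.\<close>

lemma mat_trace_adjoint_self:
  assumes A: "A \<in> carrier_mat m n"
  shows "mat_trace (mat_adjoint A * A) = of_real (\<Sum>j<n. \<Sum>i<m. (cmod (A $$ (i, j)))\<^sup>2)"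
proof -
  have "mat_trace (mat_adjoint A * A) = (\<Sum>j<n. \<Sum>i<m. cnj (A $$ (i, j)) * A $$ (i, j))"
    using A mat_adjoint_carrier[OF A]
    by (auto simp: mat_trace_def scalar_prod_def atLeast0LessThan index_mat_adjoint[OF A]
        intro!: sum.cong)
  also have "\<dots> = of_real (\<Sum>j<n. \<Sum>i<m. (cmod (A $$ (i, j)))\<^sup>2)"
    unfolding of_real_sum complex_norm_square by (simp add: mult.commute)
  finally show ?thesis .
qed

lemma smult_smult_mat:
  fixes A :: "'a :: semigroup_mult mat"
  shows "a \<cdot>\<^sub>m (b \<cdot>\<^sub>m A) = (a * b) \<cdot>\<^sub>m A"
  by (rule eq_matI) (simp_all add: mult.assoc)

text \<open>The matrix type does not fix the dimension, so \<open>d\<close> is given explicitly and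
  the empty sum is the zero matrix of that size. As for \<open>sum\<close>, an infinite index set
  also yields zero, which keeps the rules below valid for every \<open>I\<close>.\<close>

definition sum_mats :: "nat \<Rightarrow> ('a \<Rightarrow> complex mat) \<Rightarrow> 'a set \<Rightarrow> complex mat"
  where "sum_mats d F I = mat d d (\<lambda>ij. \<Sum>x\<in>I. F x $$ ij)"

lemma sum_mats_carrier [simp]: "sum_mats d F I \<in> carrier_mat d d"
  by (simp add: sum_mats_def)

lemma sum_mats_cong:
  "(\<And>x. x \<in> I \<Longrightarrow> F x = F' x) \<Longrightarrow> sum_mats d F I = sum_mats d F' I"
  by (simp add: sum_mats_def)

lemma sum_mats_reindex:
  assumes "bij_betw h I J"
  shows "sum_mats d (\<lambda>x. F (h x)) I = sum_mats d F J"
  unfolding sum_mats_def using sum.reindex_bij_betw[OF assms] by (intro cong_mat) auto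

lemma mult_sum_mats:
  assumes A: "A \<in> carrier_mat d d" and F: "\<And>x. x \<in> I \<Longrightarrow> F x \<in> carrier_mat d d"
  shows "A * sum_mats d F I = sum_mats d (\<lambda>x. A * F x) I"
proof (rule eq_matI)
  fix i j assume "i < dim_row (sum_mats d (\<lambda>x. A * F x) I)" "j < dim_col (sum_mats d (\<lambda>x. A * F x) I)"
  then have ij: "i < d" "j < d" by (simp_all add: sum_mats_def)
  have "(A * sum_mats d F I) $$ (i, j) = (\<Sum>l = 0..<d. \<Sum>x\<in>I. A $$ (i, l) * F x $$ (l, j))"
    using A ij by (auto simp: sum_mats_def scalar_prod_def sum_distrib_left intro!: sum.cong)
  also have "\<dots> = (\<Sum>x\<in>I. \<Sum>l = 0..<d. A $$ (i, l) * F x $$ (l, j))"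
    by (rule sum.swap)
  also have "\<dots> = (\<Sum>x\<in>I. (A * F x) $$ (i, j))"
  proof (intro sum.cong refl)
    fix x assume "x \<in> I"
    from F[OF this] show "(\<Sum>l = 0..<d. A $$ (i, l) * F x $$ (l, j)) = (A * F x) $$ (i, j)"
      using A ij by (auto simp: scalar_prod_def intro!: sum.cong)
  qed
  also have "\<dots> = sum_mats d (\<lambda>x. A * F x) I $$ (i, j)"
    using ij by (simp add: sum_mats_def)
  finally show "(A * sum_mats d F I) $$ (i, j) = sum_mats d (\<lambda>x. A * F x) I $$ (i, j)" .
qed (use A in \<open>auto simp: sum_mats_def\<close>)

lemma sum_mats_mult:
  assumes A: "A \<in> carrier_mat d d" and F: "\<And>x. x \<in> I \<Longrightarrow> F x \<in> carrier_mat d d"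
  shows "sum_mats d F I * A = sum_mats d (\<lambda>x. F x * A) I"
proof (rule eq_matI)
  fix i j assume "i < dim_row (sum_mats d (\<lambda>x. F x * A) I)" "j < dim_col (sum_mats d (\<lambda>x. F x * A) I)"
  then have ij: "i < d" "j < d" by (simp_all add: sum_mats_def)
  have "(sum_mats d F I * A) $$ (i, j) = (\<Sum>l = 0..<d. \<Sum>x\<in>I. F x $$ (i, l) * A $$ (l, j))"
    using A ij by (auto simp: sum_mats_def scalar_prod_def sum_distrib_right intro!: sum.cong)
  also have "\<dots> = (\<Sum>x\<in>I. \<Sum>l = 0..<d. F x $$ (i, l) * A $$ (l, j))"
    by (rule sum.swap)
  also have "\<dots> = (\<Sum>x\<in>I. (F x * A) $$ (i, j))"
  proof (intro sum.cong refl)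
    fix x assume "x \<in> I"
    from F[OF this] show "(\<Sum>l = 0..<d. F x $$ (i, l) * A $$ (l, j)) = (F x * A) $$ (i, j)"
      using A ij by (auto simp: scalar_prod_def intro!: sum.cong)
  qed
  also have "\<dots> = sum_mats d (\<lambda>x. F x * A) I $$ (i, j)"
    using ij by (simp add: sum_mats_def)
  finally show "(sum_mats d F I * A) $$ (i, j) = sum_mats d (\<lambda>x. F x * A) I $$ (i, j)" .
qed (use A in \<open>auto simp: sum_mats_def\<close>)

lemma mat_trace_sum_mats:
  assumes F: "\<And>x. x \<in> I \<Longrightarrow> F x \<in> carrier_mat d d"
  shows "mat_trace (sum_mats d F I) = (\<Sum>x\<in>I. mat_trace (F x))"
proof -
  have "mat_trace (sum_mats d F I) = (\<Sum>i<d. \<Sum>x\<in>I. F x $$ (i, i))"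
    by (simp add: mat_trace_def sum_mats_def)
  also have "\<dots> = (\<Sum>x\<in>I. \<Sum>i<d. F x $$ (i, i))"
    by (rule sum.swap)
  also have "\<dots> = (\<Sum>x\<in>I. mat_trace (F x))"
    using F by (intro sum.cong) (force simp: mat_trace_def)+
  finally show ?thesis .
qed

lemma mat_adjoint_sum_mats:
  assumes F: "\<And>x. x \<in> I \<Longrightarrow> F x \<in> carrier_mat d d"
  shows "mat_adjoint (sum_mats d F I) = sum_mats d (\<lambda>x. mat_adjoint (F x)) I"
proof (rule eq_matI)
  fix i j assume "i < dim_row (sum_mats d (\<lambda>x. mat_adjoint (F x)) I)"
    and "j < dim_col (sum_mats d (\<lambda>x. mat_adjoint (F x)) I)"
  then have "i < d" "j < d" by (simp_all add: sum_mats_def)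
  then show "mat_adjoint (sum_mats d F I) $$ (i, j) = sum_mats d (\<lambda>x. mat_adjoint (F x)) I $$ (i, j)"
    by (simp add: index_mat_adjoint[OF sum_mats_carrier]) (simp add: sum_mats_def index_mat_adjoint[OF F])
qed (simp_all add: sum_mats_def)

section \<open>The averaged inner product of a finite group representation\<close>

locale finite_group_rep = group G for G (structure) +
  fixes d :: nat and \<rho> :: "'a \<Rightarrow> complex mat"
  assumes finite_carrier: "finite (carrier G)"
    and rep_carrier [simp]: "x \<in> carrier G \<Longrightarrow> \<rho> x \<in> carrier_mat d d"
    and rep_mult: "\<lbrakk>x \<in> carrier G; y \<in> carrier G\<rbrakk> \<Longrightarrow> \<rho> (x \<otimes> y) = \<rho> x * \<rho> y"
    and rep_one: "\<rho> \<one> = 1\<^sub>m d"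
begin

text \<open>The Gram matrix of the averaged inner product, for which the representation is unitary.\<close>

definition gram :: "complex mat"
  where "gram = sum_mats d (\<lambda>x. mat_adjoint (\<rho> x) * \<rho> x) (carrier G)"

lemma gram_carrier [simp]: "gram \<in> carrier_mat d d"
  by (simp add: gram_def)

lemma gram_term_carrier: "x \<in> carrier G \<Longrightarrow> mat_adjoint (\<rho> x) * \<rho> x \<in> carrier_mat d d"
  by (meson mat_adjoint_carrier mult_carrier_mat rep_carrier)

lemma mat_adjoint_gram: "mat_adjoint gram = gram"
proof -
  have "mat_adjoint (mat_adjoint (\<rho> x) * \<rho> x) = mat_adjoint (\<rho> x) * \<rho> x" if "x \<in> carrier G" for x
    using rep_carrier[OF that] mat_adjoint_carrier[OF rep_carrier[OF that]]
    by (simp add: mat_adjoint_mult[of _ d d _ d] mat_adjoint_adjoint[of _ d d])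
  then show ?thesis
    unfolding gram_def by (subst mat_adjoint_sum_mats) (auto intro: gram_term_carrier sum_mats_cong)
qed

lemma sandwich_gram:
  assumes A: "A \<in> carrier_mat d d" and B: "B \<in> carrier_mat d d"
  shows "A * gram * B = sum_mats d (\<lambda>x. A * (mat_adjoint (\<rho> x) * \<rho> x) * B) (carrier G)"
proof -
  have 1: "A * gram = sum_mats d (\<lambda>x. A * (mat_adjoint (\<rho> x) * \<rho> x)) (carrier G)"
    unfolding gram_def by (rule mult_sum_mats[OF A gram_term_carrier])
  show ?thesis unfolding 1
    by (rule sum_mats_mult[OF B]) (meson A gram_term_carrier mult_carrier_mat)
qed

lemma trace_sandwich_gram:
  assumes A: "A \<in> carrier_mat d d" and B: "B \<in> carrier_mat d d"
  shows "mat_trace (A * gram * B)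
    = (\<Sum>x\<in>carrier G. mat_trace (A * (mat_adjoint (\<rho> x) * \<rho> x) * B))"
  unfolding sandwich_gram[OF A B]
  by (rule mat_trace_sum_mats) (meson A B gram_term_carrier mult_carrier_mat)

text \<open>Right translation by \<open>x\<close> permutes the group and hence the summands of
  \<open>gram\<close>.\<close>

lemma gram_invariant:
  assumes x: "x \<in> carrier G"
  shows "mat_adjoint (\<rho> x) * gram * \<rho> x = gram"
proof -
  note [simp] = mat_adjoint_carrier[OF rep_carrier] mult_carrier_mat[of _ d d _ d]
  have "mat_adjoint (\<rho> x) * gram * \<rho> x
      = sum_mats d (\<lambda>y. mat_adjoint (\<rho> x) * (mat_adjoint (\<rho> y) * \<rho> y) * \<rho> x) (carrier G)"
    using x by (intro sandwich_gram) auto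
  also have "\<dots> = sum_mats d (\<lambda>y. mat_adjoint (\<rho> (y \<otimes> x)) * \<rho> (y \<otimes> x)) (carrier G)"
  proof (rule sum_mats_cong)
    fix y assume y: "y \<in> carrier G"
    have "mat_adjoint (\<rho> (y \<otimes> x)) * \<rho> (y \<otimes> x)
        = (mat_adjoint (\<rho> x) * mat_adjoint (\<rho> y)) * (\<rho> y * \<rho> x)"
      using x y by (simp add: rep_mult mat_adjoint_mult[of _ d d _ d])
    also have "\<dots> = mat_adjoint (\<rho> x) * (mat_adjoint (\<rho> y) * \<rho> y) * \<rho> x"
      using x y by (simp add: assoc_mult_mat[of _ d d _ d _ d])
    finally show "mat_adjoint (\<rho> x) * (mat_adjoint (\<rho> y) * \<rho> y) * \<rho> x
        = mat_adjoint (\<rho> (y \<otimes> x)) * \<rho> (y \<otimes> x)" ..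
  qed
  also have "\<dots> = gram"
    unfolding gram_def
    by (rule sum_mats_reindex, rule bij_betwI[where g = "\<lambda>y. y \<otimes> inv x"])
      (use x in \<open>auto simp: m_assoc\<close>)
  finally show ?thesis .
qed

text \<open>The trace of \<open>mat_adjoint V * gram * V\<close> is the sum of the squared norms of
  all \<open>\<rho> x * V\<close>. If it vanishes, so does the summand at the identity, which is the
  squared norm of \<open>V\<close>.\<close>

lemma gram_mult_eq_0:
  assumes V: "V \<in> carrier_mat d d" and 0: "gram * V = 0\<^sub>m d d"
  shows "V = 0\<^sub>m d d"
proof -
  note [simp] = mat_adjoint_carrier[OF rep_carrier] mat_adjoint_carrier[OF V]
    mult_carrier_mat[of _ d d _ d]
  let ?N = "\<lambda>A. \<Sum>j<d. \<Sum>i<d. (cmod (A $$ (i, j)))\<^sup>2"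
  have "mat_trace (mat_adjoint V * gram * V) = mat_trace (mat_adjoint V * (gram * V))"
    using V by (simp add: assoc_mult_mat[of _ d d _ d _ d])
  also have "\<dots> = 0"
    using V by (simp add: 0 mat_trace_def)
  finally have "0 = mat_trace (mat_adjoint V * gram * V)" ..
  also have "\<dots> = (\<Sum>x\<in>carrier G. mat_trace (mat_adjoint V * (mat_adjoint (\<rho> x) * \<rho> x) * V))"
    using V by (intro trace_sandwich_gram) auto
  also have "\<dots> = (\<Sum>x\<in>carrier G. of_real (?N (\<rho> x * V)))"
  proof (rule sum.cong[OF refl])
    fix x assume x: "x \<in> carrier G"
    have "mat_adjoint V * (mat_adjoint (\<rho> x) * \<rho> x) * V = mat_adjoint (\<rho> x * V) * (\<rho> x * V)"
      using x V by (simp add: mat_adjoint_mult[of _ d d _ d] assoc_mult_mat[of _ d d _ d _ d])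
    then show "mat_trace (mat_adjoint V * (mat_adjoint (\<rho> x) * \<rho> x) * V) = of_real (?N (\<rho> x * V))"
      using mat_trace_adjoint_self[of "\<rho> x * V" d d] x V by simp
  qed
  also have "\<dots> = of_real (\<Sum>x\<in>carrier G. ?N (\<rho> x * V))"
    by simp
  finally have "complex_of_real (\<Sum>x\<in>carrier G. ?N (\<rho> x * V)) = 0"
    by (rule sym)
  then have "(\<Sum>x\<in>carrier G. ?N (\<rho> x * V)) = 0"
    by (simp only: of_real_eq_0_iff)
  then have "\<forall>x\<in>carrier G. ?N (\<rho> x * V) = 0"
    by (subst (asm) sum_nonneg_eq_0_iff[OF finite_carrier]) (simp_all add: sum_nonneg)
  then have "?N (\<rho> \<one> * V) = 0"
    by blast
  then have "?N V = 0"
    using V by (simp add: rep_one)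
  then have "\<forall>j<d. (\<Sum>i<d. (cmod (V $$ (i, j)))\<^sup>2) = 0"
    by (subst (asm) sum_nonneg_eq_0_iff) (simp_all add: sum_nonneg)
  then have "\<forall>j<d. \<forall>i<d. V $$ (i, j) = 0"
    by (simp add: sum_nonneg_eq_0_iff)
  then show ?thesis using V by (intro eq_matI) auto
qed

text \<open>Definiteness of \<open>gram\<close> makes it invertible, and the inverse of a
  self-adjoint matrix is self-adjoint.\<close>

lemma gram_inverse:
  obtains Q where "Q \<in> carrier_mat d d" "Q * gram = 1\<^sub>m d" "gram * Q = 1\<^sub>m d"
    "mat_adjoint Q = Q"
proof -
  have "det gram \<noteq> 0"
  proof
    assume "det gram = 0"
    then obtain v where v: "v \<in> carrier_vec d" "v \<noteq> 0\<^sub>v d" "gram *\<^sub>v v = 0\<^sub>v d"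
      using det_0_iff_vec_prod_zero[OF gram_carrier] by auto
    \<comment> \<open>The kernel vector is repeated in every column, which brings it into the square
      form that \<open>gram_mult_eq_0\<close> handles.\<close>
    define V where "V = mat d d (\<lambda>(i, j). v $ i)"
    have V: "V \<in> carrier_mat d d" by (simp add: V_def)
    have "gram * V = 0\<^sub>m d d"
    proof (rule eq_matI)
      fix i j assume ij: "i < dim_row (0\<^sub>m d d :: complex mat)" "j < dim_col (0\<^sub>m d d :: complex mat)"
      have "col V j = v" using ij v(1) by (intro eq_vecI) (auto simp: V_def)
      then have "(gram * V) $$ (i, j) = (gram *\<^sub>v v) $ i"
        using ij V carrier_matD[OF gram_carrier] by auto
      then show "(gram * V) $$ (i, j) = 0\<^sub>m d d $$ (i, j)" using ij v(3) by simp
    qed (use V carrier_matD[OF gram_carrier] in auto)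
    then have "V = 0\<^sub>m d d" by (rule gram_mult_eq_0[OF V])
    then have "v = 0\<^sub>v d"
      using v(1) by (intro eq_vecI) (auto simp: V_def mat_eq_iff)
    with v(2) show False by simp
  qed
  from det_non_zero_imp_unit[OF gram_carrier this]
  obtain Q where Q: "Q \<in> carrier_mat d d" "Q * gram = 1\<^sub>m d" "gram * Q = 1\<^sub>m d"
    unfolding Units_def by (auto simp: ring_mat_simps)
  note [simp] = mat_adjoint_carrier[OF Q(1)]
  have "mat_adjoint Q = mat_adjoint Q * (gram * Q)"
    using Q by (simp add: right_mult_one_mat[of _ d d])
  also have "\<dots> = mat_adjoint (gram * Q) * Q"
    using Q(1) by (subst mat_adjoint_mult[of _ d d _ d])
      (simp_all add: mat_adjoint_gram assoc_mult_mat[of _ d d _ d _ d])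
  also have "\<dots> = Q"
    using Q by (simp add: mat_adjoint_one left_mult_one_mat[of _ d d])
  finally show ?thesis using Q that by blast
qed

text \<open>\<open>Q * mat_adjoint A * gram\<close> is the adjoint of \<open>A\<close> for the
  averaged inner product, so this is unitarity of the representation.\<close>

lemma rep_inv_eq:
  assumes x: "x \<in> carrier G" and Q: "Q \<in> carrier_mat d d" "Q * gram = 1\<^sub>m d"
  shows "\<rho> (inv x) = Q * mat_adjoint (\<rho> x) * gram"
proof -
  note [simp] = mat_adjoint_carrier[OF rep_carrier]
  have inv: "\<rho> x * \<rho> (inv x) = 1\<^sub>m d"
    using x by (simp flip: rep_mult add: rep_one)
  have "Q * mat_adjoint (\<rho> x) * gram = Q * mat_adjoint (\<rho> x) * gram * (\<rho> x * \<rho> (inv x))"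
    unfolding inv using x Q by (simp add: right_mult_one_mat[of _ d d] mult_carrier_mat[of _ d d _ d])
  also have "\<dots> = Q * (mat_adjoint (\<rho> x) * gram * \<rho> x) * \<rho> (inv x)"
    using x Q by (simp add: assoc_mult_mat[of _ d d _ d _ d] mult_carrier_mat[of _ d d _ d])
  also have "\<dots> = \<rho> (inv x)"
    using x Q by (simp add: gram_invariant left_mult_one_mat[of _ d d])
  finally show ?thesis ..
qed

text \<open>The adjoint for the averaged inner product is similar to the ordinary one, with
  \<open>gram\<close> and \<open>Q\<close> cancelling under the trace.\<close>

lemma trace_inv:
  assumes x: "x \<in> carrier G"
  shows "mat_trace (\<rho> (inv x)) = cnj (mat_trace (\<rho> x))"
proof -
  note [simp] = mat_adjoint_carrier[OF rep_carrier] mult_carrier_mat[of _ d d _ d]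
  obtain Q where Q: "Q \<in> carrier_mat d d" "Q * gram = 1\<^sub>m d" "gram * Q = 1\<^sub>m d"
    "mat_adjoint Q = Q"
    by (rule gram_inverse)
  have "mat_trace (\<rho> (inv x)) = mat_trace (Q * (mat_adjoint (\<rho> x) * gram))"
    using x Q by (simp add: rep_inv_eq[OF x Q(1,2)] assoc_mult_mat[of _ d d _ d _ d])
  also have "\<dots> = mat_trace (mat_adjoint (\<rho> x) * gram * Q)"
    using x Q by (intro mat_trace_mult_comm[of _ d d]) auto
  also have "\<dots> = mat_trace (mat_adjoint (\<rho> x))"
    using x Q by (simp add: assoc_mult_mat[of _ d d _ d _ d] right_mult_one_mat[of _ d d])
  also have "\<dots> = cnj (mat_trace (\<rho> x))"
    using x by (intro mat_trace_adjoint[of _ d]) auto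
  finally show ?thesis .
qed

lemma trace_conj:
  assumes "x \<in> carrier G" "y \<in> carrier G"
  shows "mat_trace (\<rho> (y \<otimes> x \<otimes> inv y)) = mat_trace (\<rho> x)"
proof -
  have "mat_trace (\<rho> (y \<otimes> x \<otimes> inv y)) = mat_trace (\<rho> (y \<otimes> x) * \<rho> (inv y))"
    using assms by (simp add: rep_mult)
  also have "\<dots> = mat_trace (\<rho> (inv y) * \<rho> (y \<otimes> x))"
    using assms by (intro mat_trace_mult_comm[of _ d d]) auto
  also have "\<dots> = mat_trace (\<rho> x)"
    using assms by (simp flip: rep_mult m_assoc)
  finally show ?thesis .
qed

text \<open>
  The squared Hilbert--Schmidt norm for the averaged inner product. Writing
  \<open>Q = Q * gram * Q\<close> and expanding both Gram matrices makes it a sum of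
  terms \<open>mat_trace (mat_adjoint M * M)\<close>, so no square root of the Gram matrix is needed.
\<close>

lemma trace_hilbert_schmidt_nonneg:
  assumes A: "A \<in> carrier_mat d d"
    and Q: "Q \<in> carrier_mat d d" "Q * gram = 1\<^sub>m d" "mat_adjoint Q = Q"
  shows "0 \<le> Re (mat_trace (Q * mat_adjoint A * gram * A))"
proof -
  note [simp] = mat_adjoint_carrier[OF rep_carrier] mat_adjoint_carrier[OF A]
    mult_carrier_mat[of _ d d _ d]
  note assoc = assoc_mult_mat[of _ d d _ d _ d]
  let ?L = "\<lambda>x. Q * (mat_adjoint (\<rho> x) * \<rho> x) * (Q * mat_adjoint A)"
  have term_nonneg: "0 \<le> Re (mat_trace (?L x * (mat_adjoint (\<rho> y) * \<rho> y) * A))"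
    if x: "x \<in> carrier G" and y: "y \<in> carrier G" for x y
  proof -
    \<comment> \<open>Moving the factor \<open>Q * mat_adjoint (\<rho> x)\<close> cyclically from
      the front to the end turns the summand into \<open>mat_adjoint M * M\<close>; self-adjointness
      of \<open>Q\<close> enters here.\<close>
    define M where "M = \<rho> y * A * Q * mat_adjoint (\<rho> x)"
    have M: "M \<in> carrier_mat d d" using x y A Q by (simp add: M_def)
    have "mat_adjoint M = \<rho> x * (Q * (mat_adjoint A * mat_adjoint (\<rho> y)))"
      unfolding M_def using x y A Q
      by (simp add: mat_adjoint_mult[of _ d d _ d] mat_adjoint_adjoint[of _ d d])
    then have eq: "mat_adjoint M * M
        = (\<rho> x * Q * mat_adjoint A * (mat_adjoint (\<rho> y) * \<rho> y) * A) * (Q * mat_adjoint (\<rho> x))"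
      unfolding M_def using x y A Q by (simp add: assoc)
    have "mat_trace (?L x * (mat_adjoint (\<rho> y) * \<rho> y) * A)
        = mat_trace ((Q * mat_adjoint (\<rho> x)) *
            (\<rho> x * Q * mat_adjoint A * (mat_adjoint (\<rho> y) * \<rho> y) * A))"
      using x y A Q by (simp add: assoc)
    also have "\<dots> = mat_trace (mat_adjoint M * M)"
      unfolding eq using x y A Q by (intro mat_trace_mult_comm[of _ d d]) auto
    finally show ?thesis
      unfolding mat_trace_adjoint_self[OF M] Re_complex_of_real by (simp add: sum_nonneg)
  qed
  have "Q * gram * (Q * mat_adjoint A * gram * A) = Q * mat_adjoint A * gram * A"
    using A Q by simp
  then have "mat_trace (Q * mat_adjoint A * gram * A)
      = mat_trace (Q * gram * (Q * mat_adjoint A * gram * A))" by simp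
  also have "\<dots> = (\<Sum>x\<in>carrier G.
      mat_trace (Q * (mat_adjoint (\<rho> x) * \<rho> x) * (Q * mat_adjoint A * gram * A)))"
    using A Q by (intro trace_sandwich_gram) auto
  also have "\<dots> = (\<Sum>x\<in>carrier G. mat_trace (?L x * gram * A))"
    using A Q by (intro sum.cong refl) (simp add: assoc)
  also have "\<dots> = (\<Sum>x\<in>carrier G. \<Sum>y\<in>carrier G. mat_trace (?L x * (mat_adjoint (\<rho> y) * \<rho> y) * A))"
    using A Q by (intro sum.cong refl trace_sandwich_gram) auto
  finally show ?thesis
    using term_nonneg by (simp add: sum_nonneg)
qed

text \<open>The double sum is the squared Hilbert--Schmidt norm of the linear combination of the
  \<open>\<rho> (x i)\<close> with coefficients \<open>c i\<close>.\<close>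

lemma trace_positive_definite:
  assumes x: "\<And>i. i \<in> I \<Longrightarrow> x i \<in> carrier G"
  shows "0 \<le> Re (\<Sum>i\<in>I. \<Sum>j\<in>I. cnj (c i) * c j * mat_trace (\<rho> (inv (x i) \<otimes> x j)))"
proof -
  note [simp] = mat_adjoint_carrier[OF rep_carrier] mult_carrier_mat[of _ d d _ d]
  obtain Q where Q: "Q \<in> carrier_mat d d" "Q * gram = 1\<^sub>m d" "gram * Q = 1\<^sub>m d"
    "mat_adjoint Q = Q"
    by (rule gram_inverse)
  define A where "A = sum_mats d (\<lambda>i. c i \<cdot>\<^sub>m \<rho> (x i)) I"
  have A: "A \<in> carrier_mat d d" by (simp add: A_def)
  have "mat_adjoint A = sum_mats d (\<lambda>i. cnj (c i) \<cdot>\<^sub>m mat_adjoint (\<rho> (x i))) I"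
    unfolding A_def using x
    by (subst mat_adjoint_sum_mats) (auto simp: mat_adjoint_smult[of _ d d] intro!: sum_mats_cong)
  then have "Q * mat_adjoint A * gram
      = sum_mats d (\<lambda>i. Q * (cnj (c i) \<cdot>\<^sub>m mat_adjoint (\<rho> (x i))) * gram) I"
    using x Q by (simp add: mult_sum_mats sum_mats_mult)
  also have "\<dots> = sum_mats d (\<lambda>i. cnj (c i) \<cdot>\<^sub>m \<rho> (inv (x i))) I"
    using x Q by (intro sum_mats_cong)
      (simp add: rep_inv_eq[OF x Q(1,2)] mult_smult_distrib[of _ d d _ d] mult_smult_assoc_mat[of _ d d _ d])
  finally have "Q * mat_adjoint A * gram * A
      = sum_mats d (\<lambda>i. (cnj (c i) \<cdot>\<^sub>m \<rho> (inv (x i))) * A) I"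
    using x A by (simp add: sum_mats_mult)
  also have "mat_trace \<dots> = (\<Sum>i\<in>I. mat_trace ((cnj (c i) \<cdot>\<^sub>m \<rho> (inv (x i))) * A))"
    using x A by (intro mat_trace_sum_mats) auto
  also have "\<dots> = (\<Sum>i\<in>I. \<Sum>j\<in>I. cnj (c i) * c j * mat_trace (\<rho> (inv (x i) \<otimes> x j)))"
  proof (rule sum.cong[OF refl])
    fix i assume i: "i \<in> I"
    have "(cnj (c i) \<cdot>\<^sub>m \<rho> (inv (x i))) * A
        = sum_mats d (\<lambda>j. (cnj (c i) \<cdot>\<^sub>m \<rho> (inv (x i))) * (c j \<cdot>\<^sub>m \<rho> (x j))) I"
      unfolding A_def using x i by (intro mult_sum_mats) auto
    also have "\<dots> = sum_mats d (\<lambda>j. (cnj (c i) * c j) \<cdot>\<^sub>m \<rho> (inv (x i) \<otimes> x j)) I"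
      using x i by (intro sum_mats_cong)
        (simp add: rep_mult mult_smult_distrib[of _ d d _ d] mult_smult_assoc_mat[of _ d d _ d]
          smult_smult_mat mult.commute)
    also have "mat_trace \<dots> = (\<Sum>j\<in>I. mat_trace ((cnj (c i) * c j) \<cdot>\<^sub>m \<rho> (inv (x i) \<otimes> x j)))"
      using x i by (intro mat_trace_sum_mats) auto
    also have "\<dots> = (\<Sum>j\<in>I. cnj (c i) * c j * mat_trace (\<rho> (inv (x i) \<otimes> x j)))"
      using x i by (intro sum.cong refl mat_trace_smult[of _ d]) auto
    finally show "mat_trace ((cnj (c i) \<cdot>\<^sub>m \<rho> (inv (x i))) * A)
        = (\<Sum>j\<in>I. cnj (c i) * c j * mat_trace (\<rho> (inv (x i) \<otimes> x j)))" .
  qed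
  finally show ?thesis
    using trace_hilbert_schmidt_nonneg[OF A Q(1,2,4)] by simp
qed

end

subsection \<open>Character values near -1\<close>

text \<open>These are the properties of a character on which the estimates rest, detached from
  matrices. A locale assumption cannot quantify over types, so the index type is fixed to
  \<open>nat\<close>; families of two or three elements suffice below.\<close>

locale normalized_character = group G for G (structure) +
  fixes \<phi> :: "'a \<Rightarrow> complex"
  assumes char_one: "\<phi> \<one> = 1"
    and char_inv: "x \<in> carrier G \<Longrightarrow> \<phi> (inv x) = cnj (\<phi> x)"
    and char_conj: "\<lbrakk>x \<in> carrier G; y \<in> carrier G\<rbrakk> \<Longrightarrow> \<phi> (y \<otimes> x \<otimes> inv y) = \<phi> x"
    and char_positive_definite:
      "\<And>(I :: nat set) c x. (\<And>i. i \<in> I \<Longrightarrow> x i \<in> carrier G) \<Longrightarrow>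
        0 \<le> Re (\<Sum>i\<in>I. \<Sum>j\<in>I. cnj (c i) * c j * \<phi> (inv (x i) \<otimes> x j))"
begin

text \<open>
  For signs \<open>a\<close> and \<open>b\<close>, the number \<open>1 - a * Re (\<phi> x)\<close> is half the squared
  distance from \<open>x\<close> to \<open>a\<close> in the Hilbert--Schmidt norm. Positive definiteness is applied to
  \<open>a * b - 2 * b * x + x * y\<close>, which is the parallelogram inequality for
  \<open>x * y - a * b = x * (y - b) + b * (x - a)\<close>.
\<close>

lemma defect_mult_le:
  fixes a b :: real
  assumes x: "x \<in> carrier G" and y: "y \<in> carrier G" and ab: "a\<^sup>2 = 1" "b\<^sup>2 = 1"
  shows "1 - a * b * Re (\<phi> (x \<otimes> y)) \<le> 2 * (1 - a * Re (\<phi> x)) + 2 * (1 - b * Re (\<phi> y))"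
proof -
  define w where "w i = (if i = 0 then \<one> else if i = 1 then x else x \<otimes> y)" for i :: nat
  define c where "c i = complex_of_real (if i = 0 then a * b else if i = 1 then - 2 * b else 1)"
    for i :: nat
  have "0 \<le> Re (\<Sum>i\<in>{0, 1, 2}. \<Sum>j\<in>{0, 1, 2}. cnj (c i) * c j * \<phi> (inv (w i) \<otimes> w j))"
    by (rule char_positive_definite) (use x y in \<open>auto simp: w_def\<close>)
  moreover have "inv x \<otimes> (x \<otimes> y) = y"
    using x y by (simp flip: m_assoc)
  moreover have "inv (x \<otimes> y) \<otimes> x = inv y"
    using x y by (simp add: inv_mult_group m_assoc)
  \<comment> \<open>Once the squares of \<open>a\<close> and \<open>b\<close> are replaced by 1,
    this is twice the claimed inequality.\<close>
  ultimately have "0 \<le> a * b * (a * b) + 4 * (b * b) + 1 - 4 * (a * (b * b)) * Re (\<phi> x)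
      + 2 * (a * b) * Re (\<phi> (x \<otimes> y)) - 4 * b * Re (\<phi> y)"
    using x y by (simp add: w_def c_def char_one char_inv algebra_simps)
  moreover have "a * b * (a * b) = a\<^sup>2 * b\<^sup>2" "b * b = b\<^sup>2"
    by (simp_all add: power2_eq_square)
  ultimately show ?thesis by (simp add: ab)
qed

text \<open>Positive definiteness applied to \<open>1 + a * x\<close> for both signs
  \<open>a\<close>.\<close>

lemma abs_Re_char_le_1:
  assumes x: "x \<in> carrier G"
  shows "\<bar>Re (\<phi> x)\<bar> \<le> 1"
proof -
  have "0 \<le> 1 + a * Re (\<phi> x)" if "a * a = 1" for a :: real
  proof -
    define w where "w i = (if i = 0 then \<one> else x)" for i :: nat
    define c where "c i = complex_of_real (if i = 0 then 1 else a)" for i :: nat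
    have "0 \<le> Re (\<Sum>i\<in>{0, 1}. \<Sum>j\<in>{0, 1}. cnj (c i) * c j * \<phi> (inv (w i) \<otimes> w j))"
      by (rule char_positive_definite) (use x in \<open>auto simp: w_def\<close>)
    then show ?thesis
      using x that by (simp add: w_def c_def char_one char_inv)
  qed
  from this[of 1] this[of "-1"] show ?thesis by simp
qed

end

text \<open>The homomorphism into the unit group is unfolded into matrix identities. Division by
  \<open>d > 0\<close> preserves positivity and makes the value at the identity 1.\<close>

lemma normalized_irreducible_character_imp:
  fixes G (structure)
  assumes "group G" "finite (carrier G)" "normalized_irreducible_character G \<phi>"
  shows "normalized_character G \<phi>"
proof -
  interpret group G by fact
  obtain d \<rho> where irr: "irreducible_representation G d \<rho>"
    and \<phi>: "\<And>x. x \<in> carrier G \<Longrightarrow> \<phi> x = mat_trace (\<rho> x) / of_nat d"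
    using assms(3) unfolding normalized_irreducible_character_def by auto
  have \<rho>: "complex_representation G d \<rho>" and d: "d > 0"
    using irr by (simp_all only: irreducible_representation_def)
  interpret M: ring "ring_mat TYPE(complex) d ()" by (rule ring_mat)
  have U: "group_hom G (units_of (ring_mat TYPE(complex) d ())) \<rho>"
    using \<rho> unfolding complex_representation_def
    by (intro group_hom.intro group_hom_axioms.intro M.units_group is_group)
  interpret finite_group_rep G d \<rho>
  proof
    show "\<rho> x \<in> carrier_mat d d" if "x \<in> carrier G" for x
      using M.Units_closed[of "\<rho> x"] group_hom.hom_closed[OF U that]
      by (simp add: units_of_carrier ring_mat_simps)
    show "\<rho> (x \<otimes> y) = \<rho> x * \<rho> y" if "x \<in> carrier G" "y \<in> carrier G" for x y
      using group_hom.hom_mult[OF U that] by (simp add: units_of_mult ring_mat_simps)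
    show "\<rho> \<one> = 1\<^sub>m d"
      using group_hom.hom_one[OF U] by (simp add: units_of_one ring_mat_simps)
  qed (rule assms(2))
  show ?thesis
  proof
    show "\<phi> \<one> = 1"
      using d by (simp add: \<phi> rep_one mat_trace_def)
    show "\<phi> (inv x) = cnj (\<phi> x)" if "x \<in> carrier G" for x
      using that by (simp add: \<phi> trace_inv)
    show "\<phi> (y \<otimes> x \<otimes> inv y) = \<phi> x" if "x \<in> carrier G" "y \<in> carrier G" for x y
      using that by (simp add: \<phi> trace_conj)
    fix I :: "nat set" and c x
    assume x: "\<And>i. i \<in> I \<Longrightarrow> x i \<in> carrier G"
    let ?T = "\<Sum>i\<in>I. \<Sum>j\<in>I. cnj (c i) * c j * mat_trace (\<rho> (inv (x i) \<otimes> x j))"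
    have eq: "(\<Sum>i\<in>I. \<Sum>j\<in>I. cnj (c i) * c j * \<phi> (inv (x i) \<otimes> x j)) = ?T / of_nat d"
      using x by (simp add: \<phi> sum_divide_distrib)
    show "0 \<le> Re (\<Sum>i\<in>I. \<Sum>j\<in>I. cnj (c i) * c j * \<phi> (inv (x i) \<otimes> x j))"
      unfolding eq Re_divide_of_nat
      by (rule divide_nonneg_nonneg[OF trace_positive_definite[OF x] of_nat_0_le_iff])
  qed
qed

lemma char_constant_on_alt_cycle_class:
  assumes \<phi>: "normalized_character (alt_group n) \<phi>"
    and \<sigma>: "even_cycle_structure \<sigma> q" "q + 2 \<le> n"
    and g: "g \<in> alt_cycle_class n \<sigma>" "g' \<in> alt_cycle_class n \<sigma>"
  shows "\<phi> g' = \<phi> g"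
proof -
  interpret normalized_character "alt_group n" \<phi> by fact
  have "g' \<in> conjugacy_class (alt_group n) g"
    using alt_cycle_class_eq_conjugacy_class[OF \<sigma> g(1)] g(2) by blast
  then show ?thesis
    using char_conj g(1) unfolding conjugacy_class_def alt_cycle_class_def by auto
qed

text \<open>
  The constant must not depend on \<open>n\<close>: the factorisation of \<open>t\<close> into
  3-cycles, hence into an even number of elements of the class, is taken in \<open>alt_group m\<close>.
\<close>

lemma defect_le_of_even_word:
  assumes \<sigma>: "even_cycle_structure \<sigma> q" and s: "s \<in> alt_cycle_class (q + 2) \<sigma>" "s \<noteq> id"
    and t: "t \<in> carrier (alt_group (q + 2))"
  shows "\<exists>K\<ge>0. \<forall>n\<ge>q + 2. \<forall>\<phi>. normalized_character (alt_group n) \<phi> \<longrightarrow>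
    1 - Re (\<phi> t) \<le> K * (1 + Re (\<phi> s))"
proof -
  define m where "m = q + 2"
  have "t \<in> generate (alt_group m) (three_cycles m)"
    using t alt_group_carrier_as_three_cycles[of m] by (simp add: m_def)
  have incl_bound: "\<exists>K\<ge>0. \<forall>n\<ge>m. \<forall>\<phi>. normalized_character (alt_group n) \<phi> \<longrightarrow>
      1 - Re (\<phi> t) \<le> K * (1 + Re (\<phi> s))" if incl: "t \<in> three_cycles m" for t
  proof -
    have "card (perm_support s) < m"
      using even_cycle_structure_card[OF \<sigma> s(1)] by (simp add: m_def)
    then obtain s1 s2 where s12: "s1 \<in> alt_cycle_class m \<sigma>" "s2 \<in> alt_cycle_class m \<sigma>" "t = s1 \<circ> s2"
      using three_cycle_eq_class_mult[of s m \<sigma> t] s incl by (auto simp: m_def)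
    \<comment> \<open>Both factors have the value \<open>\<phi> s\<close>, and with both signs
      \<open>-1\<close> each contributes twice its defect from \<open>-1\<close>, whence the
      4.\<close>
    have "1 - Re (\<phi> t) \<le> 4 * (1 + Re (\<phi> s))"
      if n: "m \<le> n" and \<phi>: "normalized_character (alt_group n) \<phi>" for n \<phi>
    proof -
      interpret normalized_character "alt_group n" \<phi> by fact
      have mem: "x \<in> alt_cycle_class n \<sigma>" if "x \<in> alt_cycle_class m \<sigma>" for x
        using alt_cycle_class_mono[OF n] that by blast
      have eq: "\<phi> s1 = \<phi> s" "\<phi> s2 = \<phi> s"
        using char_constant_on_alt_cycle_class[OF \<phi> \<sigma>] mem s12 s n by (simp_all add: m_def)
      have "s1 \<in> carrier (alt_group n)" "s2 \<in> carrier (alt_group n)"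
        using mem s12 by (auto simp: alt_cycle_class_def)
      then show ?thesis
        using defect_mult_le[of s1 s2 "-1" "-1"] by (simp add: eq s12(3) alt_group_mult)
    qed
    then show ?thesis by (intro exI[of _ 4]) auto
  qed
  from \<open>t \<in> generate (alt_group m) (three_cycles m)\<close> show ?thesis
    unfolding m_def[symmetric]
  proof (induction rule: generate.induct)
    case one
    have "1 - Re (\<phi> (\<one>\<^bsub>alt_group m\<^esub>)) \<le> 0 * (1 + Re (\<phi> s))"
      if "normalized_character (alt_group n) \<phi>" for n \<phi>
      using normalized_character.char_one[OF that] by (simp add: alt_group_one)
    then show ?case by blast
  next
    case (incl t)
    then show ?case by (rule incl_bound)
  next
    case (inv t)
    then have t: "t \<in> carrier (alt_group m)"
      using three_cycles_incl by blast
    have t_inv: "inv\<^bsub>alt_group m\<^esub> t = inv\<^bsub>alt_group n\<^esub> t" "t \<in> carrier (alt_group n)"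
      if "m \<le> n" for n
      using alt_group_carrier_mono[OF that] t by (auto simp: alt_group_inv_equality)
    \<comment> \<open>Inversion conjugates the character value, so the real part and the constant do
      not change.\<close>
    have "1 - Re (\<phi> (inv\<^bsub>alt_group m\<^esub> t)) = 1 - Re (\<phi> t)"
      if n: "m \<le> n" and \<phi>: "normalized_character (alt_group n) \<phi>" for n \<phi>
      using normalized_character.char_inv[OF \<phi> t_inv(2)[OF n]] by (simp add: t_inv(1)[OF n])
    then show ?case using incl_bound[OF inv] by simp
  next
    case (eng t1 t2)
    then obtain K1 K2 where K: "K1 \<ge> 0" "K2 \<ge> 0"
      and le: "\<And>n \<phi>. m \<le> n \<Longrightarrow> normalized_character (alt_group n) \<phi> \<Longrightarrow>
        1 - Re (\<phi> t1) \<le> K1 * (1 + Re (\<phi> s)) \<and> 1 - Re (\<phi> t2) \<le> K2 * (1 + Re (\<phi> s))"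
      by meson
    have t12: "t1 \<in> carrier (alt_group m)" "t2 \<in> carrier (alt_group m)"
      using eng.hyps alt_group_carrier_as_three_cycles by blast+
    \<comment> \<open>With both signs \<open>1\<close>, a product costs at most twice the sum of the
      two defects. The constant is thus determined by the word alone, before \<open>n\<close> and
      \<phi> are chosen.\<close>
    have "1 - Re (\<phi> (t1 \<otimes>\<^bsub>alt_group m\<^esub> t2)) \<le> (2 * K1 + 2 * K2) * (1 + Re (\<phi> s))"
      if n: "m \<le> n" and \<phi>: "normalized_character (alt_group n) \<phi>" for n \<phi>
    proof -
      interpret normalized_character "alt_group n" \<phi> by fact
      have "t1 \<in> carrier (alt_group n)" "t2 \<in> carrier (alt_group n)"
        using alt_group_carrier_mono[OF n] t12 by blast+
      then have "1 - Re (\<phi> (t1 \<circ> t2)) \<le> 2 * (1 - Re (\<phi> t1)) + 2 * (1 - Re (\<phi> t2))"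
        using defect_mult_le[of t1 t2 1 1] by (simp add: alt_group_mult)
      with le[OF n \<phi>] show ?thesis
        by (simp add: alt_group_mult algebra_simps)
    qed
    with K show ?case by (intro exI[of _ "2 * K1 + 2 * K2"]) auto
  qed
qed

text \<open>The estimate is applied to \<open>t = s\<close> itself:
  \<open>1 - r \<le> K * (1 + r)\<close> for \<open>r = Re (\<phi> s)\<close> keeps \<open>r\<close>
  at least \<open>2 / (1 + K)\<close> above \<open>-1\<close>.\<close>

lemma Re_char_bounded_away:
  assumes \<sigma>: "even_cycle_structure \<sigma> q"
  obtains \<epsilon> :: real where "\<epsilon> > 0"
    "\<And>n \<phi> g. \<lbrakk>q + 2 \<le> n; normalized_character (alt_group n) \<phi>; g \<in> alt_cycle_class n \<sigma>\<rbrakk>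
      \<Longrightarrow> \<epsilon> - 1 \<le> Re (\<phi> g)"
proof -
  obtain s where s: "s \<in> alt_cycle_class (q + 2) \<sigma>"
    using alt_cycle_class_nonempty[OF \<sigma>, of "q + 2"] by auto
  then have s_carrier: "s \<in> carrier (alt_group (q + 2))"
    by (simp add: alt_cycle_class_def)
  have "\<exists>K\<ge>0. \<forall>n\<ge>q + 2. \<forall>\<phi>. normalized_character (alt_group n) \<phi> \<longrightarrow>
    1 - Re (\<phi> s) \<le> K * (1 + Re (\<phi> s))"
  proof (cases "s = id")
    case True
    \<comment> \<open>The empty cycle structure is treated apart, since the identity yields no
      3-cycles; its character value is always 1.\<close>
    have "1 - Re (\<phi> s) \<le> 0 * (1 + Re (\<phi> s))"
      if "normalized_character (alt_group n) \<phi>" for n \<phi>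
      using normalized_character.char_one[OF that] True by (simp add: alt_group_one)
    then show ?thesis by blast
  next
    case False
    show ?thesis by (rule defect_le_of_even_word[OF \<sigma> s False s_carrier])
  qed
  then obtain K where K: "K \<ge> 0" "\<And>n \<phi>. q + 2 \<le> n \<Longrightarrow> normalized_character (alt_group n) \<phi> \<Longrightarrow>
      1 - Re (\<phi> s) \<le> K * (1 + Re (\<phi> s))"
    by meson
  show thesis
  proof
    show "2 / (1 + K) > 0" using K(1) by simp
    fix n \<phi> g assume n: "q + 2 \<le> n" and \<phi>: "normalized_character (alt_group n) \<phi>"
      and g: "g \<in> alt_cycle_class n \<sigma>"
    have "s \<in> alt_cycle_class n \<sigma>" using s alt_cycle_class_mono[OF n] by blast
    then have "\<phi> g = \<phi> s" by (rule char_constant_on_alt_cycle_class[OF \<phi> \<sigma> n _ g])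
    then show "2 / (1 + K) - 1 \<le> Re (\<phi> g)"
      using K(2)[OF n \<phi>] K(1) by (simp add: field_simps)
  qed
qed

text \<open>The class is closed under inversion, so the value on it equals its own
  conjugate.\<close>

lemma char_alt_cycle_class_real:
  assumes \<phi>: "normalized_character (alt_group n) \<phi>"
    and \<sigma>: "even_cycle_structure \<sigma> q" "q + 2 \<le> n" and g: "g \<in> alt_cycle_class n \<sigma>"
  shows "\<phi> g = of_real (Re (\<phi> g))"
proof -
  interpret normalized_character "alt_group n" \<phi> by fact
  have g_carrier: "g \<in> carrier (alt_group n)" using g by (simp add: alt_cycle_class_def)
  have "\<phi> (inv' g) = \<phi> g"
    by (rule char_constant_on_alt_cycle_class[OF \<phi> \<sigma> g alt_cycle_class_inv[OF g]])
  then have "cnj (\<phi> g) = \<phi> g"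
    using char_inv[OF g_carrier] by (simp add: alt_group_inv_equality[OF g_carrier])
  then show ?thesis
    by (metis Reals_cnj_iff complex_is_Real_iff of_real_Re)
qed

section \<open>Convergence of the infinite product\<close>

text \<open>The absolute values of the partial products decrease to some \<open>L\<close>. If
  \<open>L\<close> is nonzero, their quotients tend to 1, so a late negative factor would lie below
  \<open>\<epsilon> - 1\<close>. Hence late factors are nonnegative and the sign of the partial
  products is eventually constant.\<close>

lemma convergent_prod_of_bounded_away_from_minus_1:
  fixes u :: "nat \<Rightarrow> real"
  assumes \<epsilon>: "\<epsilon> > 0" and u: "\<And>i. i \<ge> 1 \<Longrightarrow> \<epsilon> - 1 \<le> u i" "\<And>i. i \<ge> 1 \<Longrightarrow> \<bar>u i\<bar> \<le> 1"
  shows "convergent (\<lambda>N. \<Prod>i=1..N. u i)"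
proof -
  define P where "P N = (\<Prod>i=1..N. u i)" for N
  have P_Suc: "P (Suc N) = P N * u (Suc N)" for N by (simp add: P_def)
  have "decseq (\<lambda>N. \<bar>P N\<bar>)"
    using u(2) by (auto simp: decseq_Suc_iff P_Suc abs_mult intro!: mult_left_le)
  then obtain L where L: "(\<lambda>N. \<bar>P N\<bar>) \<longlonglongrightarrow> L"
    using decseq_convergent[of "\<lambda>N. \<bar>P N\<bar>" 0] by auto
  show ?thesis
  proof (cases "L = 0")
    case True
    then have "P \<longlonglongrightarrow> 0" using L tendsto_rabs_zero_iff by blast
    then show ?thesis unfolding P_def convergent_def by blast
  next
    case False
    have "(\<lambda>N. \<bar>P (Suc N)\<bar> / \<bar>P N\<bar>) \<longlonglongrightarrow> L / L"
      by (rule tendsto_divide[OF LIMSEQ_Suc[OF L] L False])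
    then have "eventually (\<lambda>N. 1 - \<epsilon> < \<bar>P (Suc N)\<bar> / \<bar>P N\<bar>) sequentially"
      using \<epsilon> False by (auto intro: order_tendstoD)
    then obtain N0 where N0: "\<And>N. N \<ge> N0 \<Longrightarrow> 1 - \<epsilon> < \<bar>P (Suc N)\<bar> / \<bar>P N\<bar>"
      unfolding eventually_sequentially by blast
    have pos: "0 \<le> u (Suc N)" if "N \<ge> N0" for N
    proof (cases "P N = 0")
      \<comment> \<open>Division by zero makes the quotient 0, so the choice of \<open>N0\<close>
        forces \<open>\<epsilon> > 1\<close>, and the lower bound on the factor is then
        positive.\<close>
      case True
      then show ?thesis using N0[OF that] u(1)[of "Suc N"] by simp
    next
      case False
      then have "1 - \<epsilon> < \<bar>u (Suc N)\<bar>"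
        using N0[OF that] by (simp add: P_Suc abs_mult)
      then show ?thesis using u(1)[of "Suc N"] by simp
    qed
    have "P N = sgn (P N0) * \<bar>P N\<bar>" if "N \<ge> N0" for N
      using that
    proof (induction N rule: dec_induct)
      case base
      show ?case by (simp add: sgn_mult_abs)
    next
      case (step N)
      then show ?case using pos[of N] by (simp add: P_Suc abs_mult)
    qed
    then have "eventually (\<lambda>N. sgn (P N0) * \<bar>P N\<bar> = P N) sequentially"
      unfolding eventually_sequentially by metis
    moreover have "(\<lambda>N. sgn (P N0) * \<bar>P N\<bar>) \<longlonglongrightarrow> sgn (P N0) * L"
      by (rule tendsto_mult_left[OF L])
    ultimately have "P \<longlonglongrightarrow> sgn (P N0) * L"
      by (rule Lim_transform_eventually[rotated])
    then show ?thesis unfolding P_def convergent_def by blast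
  qed
qed

theorem theorem1p11:
  fixes \<sigma> :: "nat multiset" and q :: nat
  assumes "even_cycle_structure \<sigma> q"
  shows "(\<forall>n \<ge> q + 2. is_conjugacy_class (alt_group n) (alt_cycle_class n \<sigma>)) \<and>
    (\<forall>(n :: nat \<Rightarrow> nat) (\<phi> :: nat \<Rightarrow> (nat \<Rightarrow> nat) \<Rightarrow> complex) (g :: nat \<Rightarrow> nat \<Rightarrow> nat).
      strict_mono_on {1..} n \<and> n 1 \<ge> q + 2 \<and>
      (\<forall>i \<ge> 1. normalized_irreducible_character (alt_group (n i)) (\<phi> i)) \<and>
      (\<forall>i \<ge> 1. g i \<in> alt_cycle_class (n i) \<sigma>)
      \<longrightarrow> convergent (\<lambda>N. \<Prod>i=1..N. \<phi> i (g i)))"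
proof (intro conjI allI)
  fix n
  show "q + 2 \<le> n \<longrightarrow> is_conjugacy_class (alt_group n) (alt_cycle_class n \<sigma>)"
  proof
    assume n: "q + 2 \<le> n"
    obtain g where g: "g \<in> alt_cycle_class n \<sigma>"
      using alt_cycle_class_nonempty[OF assms, of n] n by auto
    then show "is_conjugacy_class (alt_group n) (alt_cycle_class n \<sigma>)"
      using alt_cycle_class_eq_conjugacy_class[OF assms n g]
      by (auto simp: is_conjugacy_class_def alt_cycle_class_def)
  qed
next
  fix n :: "nat \<Rightarrow> nat" and \<phi> :: "nat \<Rightarrow> (nat \<Rightarrow> nat) \<Rightarrow> complex" and g :: "nat \<Rightarrow> nat \<Rightarrow> nat"
  show "strict_mono_on {1..} n \<and> n 1 \<ge> q + 2 \<and>
      (\<forall>i \<ge> 1. normalized_irreducible_character (alt_group (n i)) (\<phi> i)) \<and>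
      (\<forall>i \<ge> 1. g i \<in> alt_cycle_class (n i) \<sigma>)
      \<longrightarrow> convergent (\<lambda>N. \<Prod>i=1..N. \<phi> i (g i))"
  proof (rule impI, elim conjE)
    assume mono: "strict_mono_on {1..} n" and n1: "q + 2 \<le> n 1"
      and irr: "\<forall>i\<ge>1. normalized_irreducible_character (alt_group (n i)) (\<phi> i)"
      and g: "\<forall>i\<ge>1. g i \<in> alt_cycle_class (n i) \<sigma>"
    have n: "q + 2 \<le> n i" if "i \<ge> 1" for i
      using n1 that strict_mono_on_leD[OF mono, of 1 i] by simp
    have "finite (carrier (alt_group k))" for k
      by (rule finite_subset[OF _ finite_permutations[of "{1..k}"]]) (auto simp: alt_group_carrier)
    then have char: "normalized_character (alt_group (n i)) (\<phi> i)" if "i \<ge> 1" for i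
      by (intro normalized_irreducible_character_imp alt_group_is_group irr[rule_format] that)
    obtain \<epsilon> :: real where \<epsilon>: "\<epsilon> > 0"
      and bound: "\<And>n \<phi> g. \<lbrakk>q + 2 \<le> n; normalized_character (alt_group n) \<phi>; g \<in> alt_cycle_class n \<sigma>\<rbrakk>
        \<Longrightarrow> \<epsilon> - 1 \<le> Re (\<phi> g)"
      using Re_char_bounded_away[OF assms] by metis
    \<comment> \<open>The values on the class are real, so convergence is shown for the real parts
      and carried back to the complex product.\<close>
    have "convergent (\<lambda>N. \<Prod>i=1..N. Re (\<phi> i (g i)))"
    proof (rule convergent_prod_of_bounded_away_from_minus_1[OF \<epsilon>])
      fix i :: nat assume i: "i \<ge> 1"
      show "\<epsilon> - 1 \<le> Re (\<phi> i (g i))" by (rule bound[OF n[OF i] char[OF i] g[rule_format, OF i]])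
      show "\<bar>Re (\<phi> i (g i))\<bar> \<le> 1"
        using normalized_character.abs_Re_char_le_1[OF char[OF i]] g[rule_format, OF i]
        by (simp add: alt_cycle_class_def)
    qed
    then obtain L where "(\<lambda>N. \<Prod>i=1..N. Re (\<phi> i (g i))) \<longlonglongrightarrow> L"
      unfolding convergent_def by blast
    from tendsto_of_real[OF this]
    have conv: "convergent (\<lambda>N. complex_of_real (\<Prod>i=1..N. Re (\<phi> i (g i))))"
      by (rule convergentI)
    have real: "\<phi> i (g i) = complex_of_real (Re (\<phi> i (g i)))" if i: "i \<ge> 1" for i
      by (rule char_alt_cycle_class_real[OF char[OF i] assms n[OF i] g[rule_format, OF i]])
    have "(\<Prod>i=1..N. \<phi> i (g i)) = (\<Prod>i=1..N. complex_of_real (Re (\<phi> i (g i))))" for N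
      by (rule prod.cong[OF refl]) (use real in simp)
    with conv show "convergent (\<lambda>N. \<Prod>i=1..N. \<phi> i (g i))" by (simp only: of_real_prod)
  qed
qed

end
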